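(* Let $A$ be an associative algebra with product $\mu$, $M$ an $A$-bimodule with left and right actions $l_M,r_M$, and $P:M\to A$ a relative averaging operator. Then there is a bijection between the set of equivalence classes of infinitesimal deformations of the relative averaging algebra $M\xrightarrow{P}A$ and the second cohomology group $H^2_{\mathrm{rAvg}}(M\xrightarrow{P}A)$.
   Context: Everything is over a field $\mathbf k$ of characteristic $0$. $\cdot$ is the product $\mu$ of $A$ and $\cdot_M$ denotes both $A$-actions on $M$. A relative averaging operator is a linear map $P:M\to A$ with $P(u)\cdot P(v)=P(P(u)\cdot_M v)=P(u\cdot_M P(v))$ for all $u,v\in M$; the triple $(A,M,P)$ is called a relative averaging algebra, written $M\xrightarrow{P}A$. A morphism from $M\xrightarrow{P}A$ to $M'\xrightarrow{P'}A'$ is a pair $(\varphi,\psi)$ of an algebra morphism $\varphi:A\to A'$ and a linear map $\psi:M\to M'$ with $\psi(a\cdot u)=\varphi(a)\cdot\psi(u)$, $\psi(u\cdot a)=\psi(u)\cdot\varphi(a)$, $\varphi\circ P=P'\circ\psi$. The same definitions are used over any commutative unital base ring $\mathsf R$. Infinitesimal deformations. Let $\mathsf R=\mathbf k[[t]]/(t^2)$ with augmentation $\varepsilon:\mathsf R\to\mathbf k$, $t\mapsto0$. An infinitesimal deformation of $M\xrightarrow{P}A$ is a quadruple $(\mu_t,l_t,r_t,P_t)$ of $\mathsf R$-(bi)linear maps $\mu_t=\mu+t\mu_1$ on $\mathsf R\otimes A$, $l_t=l_M+tl_1:(\mathsf R\otimes A)\times(\mathsf R\otimes M)\to\mathsf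 R\otimes M$, $r_t=r_M+tr_1:(\mathsf R\otimes M)\times(\mathsf R\otimes A)\to\mathsf R\otimes M$, $P_t=P+tP_1:\mathsf R\otimes M\to\mathsf R\otimes A$ (with $\mu_1:A\times A\to A$, $l_1:A\times M\to M$, $r_1:M\times A\to M$ bilinear and $P_1:M\to A$ linear) making $\mathsf R\otimes M\xrightarrow{P_t}\mathsf R\otimes A$ a relative averaging algebra over $\mathsf R$. Two infinitesimal deformations are equivalent if there is an isomorphism of relative averaging algebras over $\mathsf R$ between them of the form $(\varphi_t,\psi_t)=(\mathrm{id}_A+t\varphi_1,\mathrm{id}_M+t\psi_1)$ with $\varphi_1:A\to A$, $\psi_1:M\to M$ linear. Trees. $Y_n$ ($n\ge 1$) is the set of planar binary trees with $n$ trivalent vertices, one root and $n+1$ leaves labelled $0,\dots,n$ from left to right; $Y_0=\{|\}$. $y_1\vee y_2$ denotes grafting ($y_1$ on the left) at a new root vertex. $d_i:Y_n\to Y_{n-1}$ deletes the $i$-th leaf. For $y\in Y_n$, $n\ge1$: $\star_0^y=\dashv$ if $y=|\vee y_1$ for some $y_1\in Y_{n-1}$ and $\vdash$ otherwise; for $1\le i\le n-1$, $\star_i^y=\dashv$ if the $i$-th leaf is oriented like $\backslash$ (a left child of its vertex) and $\vdash$ if oriented like $/$ (a right child); $\star_n^y=\vdash$ if $y=y_1\vee|$ for some $y_1\in Y_{n-1}$ and $\dashv$ otherwise. Cohomology. Let $\mathcal A^{n-1,1}$ be the direct sum of all tensor products of $n-1$ copies of $A$ and one copy of $M$, in any order.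 $C^0_{\mathrm{rAvg}}=0$, $C^1_{\mathrm{rAvg}}=\mathrm{Hom}(A,A)\oplus\mathrm{Hom}(M,M)$, $C^n_{\mathrm{rAvg}}=\mathrm{Hom}(A^{\otimes n},A)\oplus\mathrm{Hom}(\mathcal A^{n-1,1},M)\oplus\mathrm{Hom}(\mathbf k[Y_{n-1}]\otimes M^{\otimes n-1},A)$ for $n\ge2$, with $$\delta_{\mathrm{rAvg}}(f,g,\gamma)=\big(\delta_{\mathrm{Hoch}}(f),\ \delta^f_{\mathrm{Hoch}}(g),\ \delta^P_{\mathrm{Diass}}(\gamma)+h_P(f,g)\big)$$ ($\gamma=0$ when $n=1$). Here $\delta_{\mathrm{Hoch}}$ is the Hochschild coboundary of $A$ with coefficients in $A$; $$\delta^f_{\mathrm{Hoch}}(g)(a_1,\dots,a_{n+1})=a_1\cdot_M(f+g)(a_2,\dots,a_{n+1})+\sum_{i=1}^n(-1)^ig(a_1,\dots,a_{i-1},(\mu+\cdot_M)(a_i,a_{i+1}),\dots,a_{n+1})+(-1)^{n+1}(f+g)(a_1,\dots,a_n)\cdot_Ma_{n+1}$$ for $a_1\otimes\cdots\otimes a_{n+1}\in\mathcal A^{n,1}$ ($f$ is applied when all arguments lie in $A$, $g$ when exactly one lies in $M$); for $\gamma\in\mathrm{Hom}(\mathbf k[Y_m]\otimes M^{\otimes m},A)$, $$\delta^P_{\mathrm{Diass}}(\gamma)(y;u_1,\dots,u_{m+1})=u_1\star_0^y\gamma(d_0y;u_2,\dots,u_{m+1})+\sum_{i=1}^m(-1)^i\gamma(d_iy;u_1,\dots,u_i(\star_i^y)_Pu_{i+1},\dots,u_{m+1})+(-1)^{m+1}\gamma(d_{m+1}y;u_1,\dots,u_m)\star_{m+1}^yu_{m+1},$$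 where $u\dashv_Pv=u\cdot_MP(v)$, $u\vdash_Pv=P(u)\cdot_Mv$, $u\dashv a=P(u)\cdot a-P(u\cdot_Ma)$, $u\vdash a=P(u)\cdot a$, $a\dashv u=a\cdot P(u)$, $a\vdash u=a\cdot P(u)-P(a\cdot_Mu)$; and for $y=y_1\vee y_2\in Y_n$ with $y_1\in Y_{i-1}$, $y_2\in Y_{n-i}$, $$h_P(f,g)(y;u_1,\dots,u_n)=(-1)^n\big\{f(P(u_1),\dots,P(u_n))-P\,g(P(u_1),\dots,P(u_{i-1}),u_i,P(u_{i+1}),\dots,P(u_n))\big\}.$$ $H^n_{\mathrm{rAvg}}(M\xrightarrow{P}A)$ is the cohomology of this cochain complex. *)

theory Defs
  imports
    "HOL-Computational_Algebra.Formal_Power_Series"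
    "HOL-Library.Product_Plus"
    "HOL-Library.Function_Algebras"
begin

section \<open>Relative averaging algebras over a commutative ring\<close>

definition bilinear_map ::
  "('r::comm_ring_1 \<Rightarrow> 'a::ab_group_add \<Rightarrow> 'a) \<Rightarrow> ('r \<Rightarrow> 'b::ab_group_add \<Rightarrow> 'b) \<Rightarrow>
   ('r \<Rightarrow> 'c::ab_group_add \<Rightarrow> 'c) \<Rightarrow> ('a \<Rightarrow> 'b \<Rightarrow> 'c) \<Rightarrow> bool" where
  "bilinear_map s1 s2 s3 f \<longleftrightarrow>
     (\<forall>x. module_hom s2 s3 (\<lambda>y. f x y)) \<and> (\<forall>y. module_hom s1 s3 (\<lambda>x. f x y))"

definition assoc_algebra ::
  "('r::comm_ring_1 \<Rightarrow> 'a::ab_group_add \<Rightarrow> 'a) \<Rightarrow> ('a \<Rightarrow> 'a \<Rightarrow> 'a) \<Rightarrow> bool" where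
  "assoc_algebra sA mu \<longleftrightarrow>
     module sA \<and> bilinear_map sA sA sA mu \<and> (\<forall>a b c. mu (mu a b) c = mu a (mu b c))"

definition bimodule ::
  "('r::comm_ring_1 \<Rightarrow> 'a::ab_group_add \<Rightarrow> 'a) \<Rightarrow> ('a \<Rightarrow> 'a \<Rightarrow> 'a) \<Rightarrow>
   ('r \<Rightarrow> 'm::ab_group_add \<Rightarrow> 'm) \<Rightarrow> ('a \<Rightarrow> 'm \<Rightarrow> 'm) \<Rightarrow> ('m \<Rightarrow> 'a \<Rightarrow> 'm) \<Rightarrow> bool" where
  "bimodule sA mu sM l r \<longleftrightarrow>
     module sM \<and> bilinear_map sA sM sM l \<and> bilinear_map sM sA sM r \<and>
     (\<forall>a b u. l (mu a b) u = l a (l b u)) \<and>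
     (\<forall>a u b. r (l a u) b = l a (r u b)) \<and>
     (\<forall>u a b. r (r u a) b = r u (mu a b))"

definition relative_averaging_operator ::
  "('r::comm_ring_1 \<Rightarrow> 'a::ab_group_add \<Rightarrow> 'a) \<Rightarrow> ('a \<Rightarrow> 'a \<Rightarrow> 'a) \<Rightarrow>
   ('r \<Rightarrow> 'm::ab_group_add \<Rightarrow> 'm) \<Rightarrow> ('a \<Rightarrow> 'm \<Rightarrow> 'm) \<Rightarrow> ('m \<Rightarrow> 'a \<Rightarrow> 'm) \<Rightarrow> ('m \<Rightarrow> 'a) \<Rightarrow> bool" where
  "relative_averaging_operator sA mu sM l r P \<longleftrightarrow>
     module_hom sM sA P \<and>
     (\<forall>u v. mu (P u) (P v) = P (l (P u) v)) \<and>
     (\<forall>u v. mu (P u) (P v) = P (r u (P v)))"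

type_synonym ('a, 'm) raa_ops =
  "('a \<Rightarrow> 'a \<Rightarrow> 'a) \<times> ('a \<Rightarrow> 'm \<Rightarrow> 'm) \<times> ('m \<Rightarrow> 'a \<Rightarrow> 'm) \<times> ('m \<Rightarrow> 'a)"

fun rel_avg_algebra ::
  "('r::comm_ring_1 \<Rightarrow> 'a::ab_group_add \<Rightarrow> 'a) \<Rightarrow> ('r \<Rightarrow> 'm::ab_group_add \<Rightarrow> 'm) \<Rightarrow>
   ('a, 'm) raa_ops \<Rightarrow> bool" where
  "rel_avg_algebra sA sM (mu, l, r, P) \<longleftrightarrow>
     assoc_algebra sA mu \<and> bimodule sA mu sM l r \<and> relative_averaging_operator sA mu sM l r P"

fun rel_avg_morphism ::
  "('r::comm_ring_1 \<Rightarrow> 'a::ab_group_add \<Rightarrow> 'a) \<Rightarrow> ('r \<Rightarrow> 'm::ab_group_add \<Rightarrow> 'm) \<Rightarrow> ('a, 'm) raa_ops \<Rightarrow>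
   ('r \<Rightarrow> 'b::ab_group_add \<Rightarrow> 'b) \<Rightarrow> ('r \<Rightarrow> 'n::ab_group_add \<Rightarrow> 'n) \<Rightarrow> ('b, 'n) raa_ops \<Rightarrow>
   ('a \<Rightarrow> 'b) \<times> ('m \<Rightarrow> 'n) \<Rightarrow> bool" where
  "rel_avg_morphism sA sM (mu, l, r, P) sA' sM' (mu', l', r', P') (\<phi>, \<psi>) \<longleftrightarrow>
     module_hom sA sA' \<phi> \<and> (\<forall>a b. \<phi> (mu a b) = mu' (\<phi> a) (\<phi> b)) \<and>
     module_hom sM sM' \<psi> \<and>
     (\<forall>a u. \<psi> (l a u) = l' (\<phi> a) (\<psi> u)) \<and>
     (\<forall>u a. \<psi> (r u a) = r' (\<psi> u) (\<phi> a)) \<and>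
     (\<forall>u. \<phi> (P u) = P' (\<psi> u))"

fun rel_avg_isomorphism ::
  "('r::comm_ring_1 \<Rightarrow> 'a::ab_group_add \<Rightarrow> 'a) \<Rightarrow> ('r \<Rightarrow> 'm::ab_group_add \<Rightarrow> 'm) \<Rightarrow> ('a, 'm) raa_ops \<Rightarrow>
   ('r \<Rightarrow> 'b::ab_group_add \<Rightarrow> 'b) \<Rightarrow> ('r \<Rightarrow> 'n::ab_group_add \<Rightarrow> 'n) \<Rightarrow> ('b, 'n) raa_ops \<Rightarrow>
   ('a \<Rightarrow> 'b) \<times> ('m \<Rightarrow> 'n) \<Rightarrow> bool" where
  "rel_avg_isomorphism sA sM S sA' sM' S' (\<phi>, \<psi>) \<longleftrightarrow>
     rel_avg_morphism sA sM S sA' sM' S' (\<phi>, \<psi>) \<and>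
     (\<exists>\<phi>' \<psi>'. rel_avg_morphism sA' sM' S' sA sM S (\<phi>', \<psi>') \<and>
        \<phi>' \<circ> \<phi> = id \<and> \<phi> \<circ> \<phi>' = id \<and> \<psi>' \<circ> \<psi> = id \<and> \<psi> \<circ> \<psi>' = id)"


section \<open>The ring \<open>k[[t]]/(t\<^sup>2)\<close>\<close>

definition fps_cong_t2 :: "'k::comm_ring_1 fps \<Rightarrow> 'k fps \<Rightarrow> bool" where
  "fps_cong_t2 f g \<longleftrightarrow> fps_X ^ 2 dvd f - g"

lemma fps_X2_dvd_iff: "fps_X ^ 2 dvd (f :: 'k::comm_ring_1 fps) \<longleftrightarrow> fps_nth f 0 = 0 \<and> fps_nth f 1 = 0"
proof
  assume "fps_X ^ 2 dvd f"
  then obtain g where "f = fps_X ^ 2 * g" by blast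
  then show "fps_nth f 0 = 0 \<and> fps_nth f 1 = 0"
    by (simp add: fps_X_power_mult_nth)
next
  assume a: "fps_nth f 0 = 0 \<and> fps_nth f 1 = 0"
  have "f = fps_X ^ 2 * fps_shift 2 f"
  proof (rule fps_ext)
    fix n :: nat
    have "n < 2 \<or> n = n - 2 + 2" by linarith
    then show "fps_nth f n = fps_nth (fps_X ^ 2 * fps_shift 2 f) n"
      using a by (auto simp: fps_X_power_mult_nth less_2_cases_iff)
  qed
  then show "fps_X ^ 2 dvd f" by (metis dvd_triv_left)
qed

lemma fps_cong_t2_iff:
  "fps_cong_t2 f g \<longleftrightarrow> fps_nth f 0 = fps_nth g 0 \<and> fps_nth f 1 = fps_nth g 1"
  by (simp add: fps_cong_t2_def fps_X2_dvd_iff)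

quotient_type (overloaded) 'k dual = "'k::comm_ring_1 fps" / fps_cong_t2
  by (rule equivpI) (auto simp: reflp_def symp_def transp_def fps_cong_t2_iff)

instantiation dual :: (comm_ring_1) comm_ring_1
begin

lift_definition zero_dual :: "'a dual" is 0 .
lift_definition one_dual :: "'a dual" is 1 .
lift_definition plus_dual :: "'a dual \<Rightarrow> 'a dual \<Rightarrow> 'a dual" is "(+)"
  by (simp add: fps_cong_t2_iff)
lift_definition minus_dual :: "'a dual \<Rightarrow> 'a dual \<Rightarrow> 'a dual" is "(-)"
  by (simp add: fps_cong_t2_iff)
lift_definition uminus_dual :: "'a dual \<Rightarrow> 'a dual" is "uminus"
  by (simp add: fps_cong_t2_iff)
lift_definition times_dual :: "'a dual \<Rightarrow> 'a dual \<Rightarrow> 'a dual" is "(*)"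
  by (simp add: fps_cong_t2_iff fps_mult_nth)

instance
  by standard (transfer; simp add: fps_cong_t2_iff fps_mult_nth algebra_simps)+

end

lift_definition dual_const :: "'k::comm_ring_1 \<Rightarrow> 'k dual" is fps_const .
lift_definition dual_t :: "'k::comm_ring_1 dual" is fps_X .
lift_definition dual_c0 :: "'k::comm_ring_1 dual \<Rightarrow> 'k" is "\<lambda>f. fps_nth f 0"
  by (simp add: fps_cong_t2_iff)
lift_definition dual_c1 :: "'k::comm_ring_1 dual \<Rightarrow> 'k" is "\<lambda>f. fps_nth f 1"
  by (simp add: fps_cong_t2_iff)

lemma dual_eq_iff: "x = y \<longleftrightarrow> dual_c0 x = dual_c0 y \<and> dual_c1 x = dual_c1 y"
  by transfer (simp add: fps_cong_t2_iff)

lemma dual_coeff_simps [simp]: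
  "dual_c0 0 = 0" "dual_c1 0 = 0" "dual_c0 1 = 1" "dual_c1 1 = 0"
  "dual_c0 (x + y) = dual_c0 x + dual_c0 y" "dual_c1 (x + y) = dual_c1 x + dual_c1 y"
  "dual_c0 (x * y) = dual_c0 x * dual_c0 y"
  "dual_c1 (x * y) = dual_c0 x * dual_c1 y + dual_c1 x * dual_c0 y"
  "dual_c0 (dual_const c) = c" "dual_c1 (dual_const c) = 0"
  "dual_c0 dual_t = 0" "dual_c1 dual_t = 1"
  by (transfer; simp add: fps_mult_nth)+


section \<open>Extension of scalars from \<open>k\<close> to \<open>k[[t]]/(t\<^sup>2)\<close>\<close>

text \<open>
  For a \<open>k\<close>-module \<open>A\<close>, the module \<open>R \<otimes> A\<close> with \<open>R = k[[t]]/(t\<^sup>2)\<close> is modelled by pairs: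
  \<open>(a\<^sub>0, a\<^sub>1)\<close> stands for \<open>1 \<otimes> a\<^sub>0 + t \<otimes> a\<^sub>1\<close>.  The universal property of the tensor product is
  \<open>dual_tensor_universal\<close> below.
\<close>

definition ext_scale ::
  "('k::comm_ring_1 \<Rightarrow> 'a::ab_group_add \<Rightarrow> 'a) \<Rightarrow> 'k dual \<Rightarrow> 'a \<times> 'a \<Rightarrow> 'a \<times> 'a" where
  "ext_scale s x p =
     (s (dual_c0 x) (fst p), s (dual_c0 x) (snd p) + s (dual_c1 x) (fst p))"

definition dual_tensor :: "('k::comm_ring_1 \<Rightarrow> 'a::ab_group_add \<Rightarrow> 'a) \<Rightarrow> 'k dual \<Rightarrow> 'a \<Rightarrow> 'a \<times> 'a" where
  "dual_tensor s x a = (s (dual_c0 x) a, s (dual_c1 x) a)"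

definition ext_lin :: "('a \<Rightarrow> 'b) \<Rightarrow> 'a \<times> 'a \<Rightarrow> 'b \<times> 'b" where
  "ext_lin f p = (f (fst p), f (snd p))"

definition ext_bil :: "('a \<Rightarrow> 'b \<Rightarrow> 'c::ab_group_add) \<Rightarrow> 'a \<times> 'a \<Rightarrow> 'b \<times> 'b \<Rightarrow> 'c \<times> 'c" where
  "ext_bil f p q = (f (fst p) (fst q), f (fst p) (snd q) + f (snd p) (fst q))"

text \<open>The maps written \<open>f + t f\<^sub>1\<close>; \<open>s\<close> is the scalar multiplication of the target of \<open>f\<close>.\<close>

definition lin_deform ::
  "('k::comm_ring_1 \<Rightarrow> 'b::ab_group_add \<Rightarrow> 'b) \<Rightarrow> ('a \<Rightarrow> 'b) \<Rightarrow> ('a \<Rightarrow> 'b) \<Rightarrow> 'a \<times> 'a \<Rightarrow> 'b \<times> 'b" where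
  "lin_deform s f f1 p = ext_lin f p + ext_scale s dual_t (ext_lin f1 p)"

definition bil_deform ::
  "('k::comm_ring_1 \<Rightarrow> 'c::ab_group_add \<Rightarrow> 'c) \<Rightarrow> ('a \<Rightarrow> 'b \<Rightarrow> 'c) \<Rightarrow> ('a \<Rightarrow> 'b \<Rightarrow> 'c) \<Rightarrow>
   'a \<times> 'a \<Rightarrow> 'b \<times> 'b \<Rightarrow> 'c \<times> 'c" where
  "bil_deform s f f1 p q = ext_bil f p q + ext_scale s dual_t (ext_bil f1 p q)"

lemma module_ext_scale:
  assumes "module s"
  shows "module (ext_scale s)"
proof -
  interpret module s by fact
  show ?thesis
    by standard
      (auto simp: ext_scale_def scale_right_distrib scale_left_distrib add_ac mult_ac)
qed

lemma module_dual: "module (\<lambda>c x. dual_const c * (x :: 'k::comm_ring_1 dual))"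
  by standard (auto simp: dual_eq_iff algebra_simps)

lemma ext_scale_dual_tensor:
  assumes "module s"
  shows "ext_scale s x (dual_tensor s y a) = dual_tensor s (x * y) a"
proof -
  interpret module s by fact
  show ?thesis
    by (simp add: ext_scale_def dual_tensor_def scale_left_distrib)
qed

lemma dual_tensor_bilinear:
  assumes "module s"
  shows "bilinear_map (\<lambda>c x. dual_const c * x) s (\<lambda>c. ext_scale s (dual_const c)) (dual_tensor s)"
proof -
  interpret module s by fact
  interpret E: module "ext_scale s" using assms by (rule module_ext_scale)
  have E': "module (\<lambda>c. ext_scale s (dual_const c))"
    by standard (auto simp: ext_scale_def scale_right_distrib scale_left_distrib)
  show ?thesis
    unfolding bilinear_map_def module_hom_def module_hom_axioms_def
    by (intro allI conjI assms E' module_dual)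
      (simp_all add: dual_tensor_def ext_scale_def scale_right_distrib scale_left_distrib mult.commute)
qed

lemma dual_tensor_universal:
  assumes "bilinear_map (\<lambda>c x. dual_const c * x) s sN \<beta>"
  shows "\<exists>!h. module_hom (\<lambda>c. ext_scale s (dual_const c)) sN h \<and>
              (\<forall>x a. h (dual_tensor s x a) = \<beta> x a)"
proof -
  have R: "module_hom s sN (\<beta> x)" for x
    using assms by (auto simp: bilinear_map_def)
  have L: "module_hom (\<lambda>c x. dual_const c * x) sN (\<lambda>x. \<beta> x a)" for a
    using assms by (auto simp: bilinear_map_def)
  interpret B1: module_hom s sN "\<beta> 1" by (rule R)
  interpret Bt: module_hom s sN "\<beta> dual_t" by (rule R)
  define h where "h p = \<beta> 1 (fst p) + \<beta> dual_t (snd p)" for p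
  have E': "module (\<lambda>c. ext_scale s (dual_const c))"
    by standard (auto simp: ext_scale_def B1.m1.scale_right_distrib B1.m1.scale_left_distrib)
  have "module_hom (\<lambda>c. ext_scale s (dual_const c)) sN h"
    unfolding module_hom_def module_hom_axioms_def
    using E' B1.m2.module_axioms
    by (auto simp: h_def ext_scale_def B1.add Bt.add B1.scale Bt.scale B1.m2.scale_right_distrib)
  moreover have "h (dual_tensor s x a) = \<beta> x a" for x a
  proof -
    have x: "x = dual_const (dual_c0 x) * 1 + dual_const (dual_c1 x) * dual_t"
      by (simp add: dual_eq_iff)
    interpret La: module_hom "\<lambda>c x. dual_const c * x" sN "\<lambda>x. \<beta> x a" by (rule L)
    have "\<beta> x a = sN (dual_c0 x) (\<beta> 1 a) + sN (dual_c1 x) (\<beta> dual_t a)"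
      by (subst x) (simp only: La.add La.scale)
    then show ?thesis
      by (simp add: h_def dual_tensor_def B1.scale Bt.scale)
  qed
  moreover have "g = h"
    if g: "module_hom (\<lambda>c. ext_scale s (dual_const c)) sN g" "\<forall>x a. g (dual_tensor s x a) = \<beta> x a" for g
  proof
    fix p
    interpret g: module_hom "\<lambda>c. ext_scale s (dual_const c)" sN g by (rule g)
    have p: "p = dual_tensor s 1 (fst p) + dual_tensor s dual_t (snd p)"
      by (simp add: dual_tensor_def prod_eq_iff)
    show "g p = h p"
      by (subst p) (simp only: g.add g(2) h_def)
  qed
  ultimately show ?thesis by blast
qed

lemma ext_lin_dual_tensor:
  assumes "module_hom s s' f"
  shows "ext_lin f (dual_tensor s x a) = dual_tensor s' x (f a)"
proof -
  interpret module_hom s s' f by fact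
  show ?thesis by (simp add: ext_lin_def dual_tensor_def scale)
qed

lemma ext_bil_dual_tensor:
  assumes "bilinear_map s1 s2 s3 f"
  shows "ext_bil f (dual_tensor s1 x a) (dual_tensor s2 y b) = dual_tensor s3 (x * y) (f a b)"
proof -
  have R: "module_hom s2 s3 (f x)" and L: "module_hom s1 s3 (\<lambda>x. f x y)" for x y
    using assms by (auto simp: bilinear_map_def)
  interpret m: module s3 using R by (auto simp: module_hom_def)
  have "f (s1 c a) (s2 d b) = s3 (c * d) (f a b)" for c d a b
    using module_hom.scale[OF L] module_hom.scale[OF R] by (simp add: mult.commute)
  then show ?thesis
    by (simp add: ext_bil_def dual_tensor_def m.scale_left_distrib)
qed


section \<open>Planar binary trees\<close>

datatype ptree = Leaf | Graft ptree ptree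

fun nodes :: "ptree \<Rightarrow> nat" where
  "nodes Leaf = 0"
| "nodes (Graft y1 y2) = nodes y1 + nodes y2 + 1"

text \<open>
  Leaves are numbered from left to right starting with \<open>0\<close>, so that the leaves of \<open>Graft y1 y2\<close>
  with numbers \<open>0, \<dots>, nodes y1\<close> are those of \<open>y1\<close>.  Values on the tree \<open>Leaf\<close> are junk.
\<close>

fun delete_leaf :: "nat \<Rightarrow> ptree \<Rightarrow> ptree" where
  "delete_leaf i Leaf = Leaf"
| "delete_leaf i (Graft y1 y2) =
     (if i \<le> nodes y1
      then (if y1 = Leaf then y2 else Graft (delete_leaf i y1) y2)
      else (if y2 = Leaf then y1 else Graft y1 (delete_leaf (i - (nodes y1 + 1)) y2)))"

fun is_left_leaf :: "nat \<Rightarrow> ptree \<Rightarrow> bool" where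
  "is_left_leaf i Leaf = False"
| "is_left_leaf i (Graft y1 y2) =
     (if i \<le> nodes y1
      then (if y1 = Leaf then True else is_left_leaf i y1)
      else (if y2 = Leaf then False else is_left_leaf (i - (nodes y1 + 1)) y2))"

datatype diass_op = Dashv | Vdash

definition star :: "nat \<Rightarrow> ptree \<Rightarrow> diass_op" where
  "star i y =
     (if i = 0 then (if \<exists>y1. y = Graft Leaf y1 then Dashv else Vdash)
      else if i = nodes y then (if \<exists>y1. y = Graft y1 Leaf then Vdash else Dashv)
      else (if is_left_leaf i y then Dashv else Vdash))"


section \<open>Multilinear maps as functions on lists\<close>

text \<open>
  An element of \<open>Hom(V\<^sup>\<otimes>\<^sup>n, W)\<close> is a function on lists which is linear in every entry of lists of
  length \<open>n\<close> and which is normalised to \<open>0\<close> on all other lists, so that equality of functions is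
  equality of multilinear maps.
\<close>

definition multilinear ::
  "('k::comm_ring_1 \<Rightarrow> 'v::ab_group_add \<Rightarrow> 'v) \<Rightarrow> ('k \<Rightarrow> 'w::ab_group_add \<Rightarrow> 'w) \<Rightarrow> nat \<Rightarrow>
   ('v list \<Rightarrow> 'w) \<Rightarrow> bool" where
  "multilinear sV sW n f \<longleftrightarrow>
     (\<forall>xs. length xs \<noteq> n \<longrightarrow> f xs = 0) \<and>
     (\<forall>xs ys. length xs + 1 + length ys = n \<longrightarrow> module_hom sV sW (\<lambda>v. f (xs @ v # ys)))"

text \<open>
  Words in \<open>A\<close> and \<open>M\<close> are lists over the sum type.  An element of \<open>Hom(\<A>\<^sup>n\<^sup>-\<^sup>1\<^sup>,\<^sup>1, M)\<close> is a function
  on such words that is multilinear on each of the \<open>n\<close> types of words of length \<open>n\<close> with exactly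
  one entry from \<open>M\<close>, and \<open>0\<close> on all other words.
\<close>

definition num_M :: "('a + 'm) list \<Rightarrow> nat" where
  "num_M ws = length (filter (\<lambda>w. \<not> isl w) ws)"

definition mixed_multilinear ::
  "('k::comm_ring_1 \<Rightarrow> 'a::ab_group_add \<Rightarrow> 'a) \<Rightarrow> ('k \<Rightarrow> 'm::ab_group_add \<Rightarrow> 'm) \<Rightarrow> nat \<Rightarrow>
   (('a + 'm) list \<Rightarrow> 'm) \<Rightarrow> bool" where
  "mixed_multilinear sA sM n g \<longleftrightarrow>
     (\<forall>ws. \<not> (length ws = n \<and> num_M ws = 1) \<longrightarrow> g ws = 0) \<and>
     (\<forall>ws vs. length ws + 1 + length vs = n \<and> num_M (ws @ vs) = 1 \<longrightarrow>
        module_hom sA sM (\<lambda>a. g (ws @ Inl a # vs))) \<and>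
     (\<forall>ws vs. length ws + 1 + length vs = n \<and> num_M (ws @ vs) = 0 \<longrightarrow>
        module_hom sM sM (\<lambda>u. g (ws @ Inr u # vs)))"

text \<open>Replace the entries number \<open>i\<close> and \<open>i + 1\<close> (counted from \<open>1\<close>) by their product.\<close>

definition contract :: "('v \<Rightarrow> 'v \<Rightarrow> 'v) \<Rightarrow> nat \<Rightarrow> 'v list \<Rightarrow> 'v list" where
  "contract p i xs = take (i - 1) xs @ p (xs ! (i - 1)) (xs ! i) # drop (i + 1) xs"

type_synonym ('a, 'm) cochain =
  "('a list \<Rightarrow> 'a) \<times> (('a + 'm) list \<Rightarrow> 'm) \<times> (ptree \<Rightarrow> 'm list \<Rightarrow> 'a)"


section \<open>Cohomology and deformations of \<open>P : M \<rightarrow> A\<close>\<close>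

locale rel_avg =
  fixes sA :: "'k::field_char_0 \<Rightarrow> 'a::ab_group_add \<Rightarrow> 'a"
    and mu :: "'a \<Rightarrow> 'a \<Rightarrow> 'a"
    and sM :: "'k \<Rightarrow> 'm::ab_group_add \<Rightarrow> 'm"
    and l :: "'a \<Rightarrow> 'm \<Rightarrow> 'm"
    and r :: "'m \<Rightarrow> 'a \<Rightarrow> 'm"
    and P :: "'m \<Rightarrow> 'a"
begin

subsection \<open>The cochain complex\<close>

definition cochains :: "nat \<Rightarrow> ('a, 'm) cochain set" where
  "cochains n =
     (if n = 0 then {0}
      else {(f, g, \<gamma>). multilinear sA sA n f \<and> mixed_multilinear sA sM n g \<and>
              (if n = 1 then \<gamma> = 0
               else \<forall>y. if nodes y = n - 1 then multilinear sM sA (n - 1) (\<gamma> y) else \<gamma> y = 0)})"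

definition delta_Hoch :: "nat \<Rightarrow> ('a list \<Rightarrow> 'a) \<Rightarrow> 'a list \<Rightarrow> 'a" where
  "delta_Hoch n f as =
     (if length as = n + 1 then
        mu (hd as) (f (tl as))
        + (\<Sum>i = 1..n. sA ((-1) ^ i) (f (contract mu i as)))
        + sA ((-1) ^ (n + 1)) (mu (f (butlast as)) (last as))
      else 0)"

fun act :: "'a + 'm \<Rightarrow> 'a + 'm \<Rightarrow> 'm" where
  "act (Inl a) (Inr u) = l a u"
| "act (Inr u) (Inl a) = r u a"
| "act _ _ = 0"

fun mu_act :: "'a + 'm \<Rightarrow> 'a + 'm \<Rightarrow> 'a + 'm" where
  "mu_act (Inl a) (Inl b) = Inl (mu a b)"
| "mu_act x y = Inr (act x y)"

definition f_plus_g :: "('a list \<Rightarrow> 'a) \<Rightarrow> (('a + 'm) list \<Rightarrow> 'm) \<Rightarrow> ('a + 'm) list \<Rightarrow> 'a + 'm" where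
  "f_plus_g f g ws = (if num_M ws = 0 then Inl (f (map projl ws)) else Inr (g ws))"

definition delta_Hoch_M ::
  "nat \<Rightarrow> ('a list \<Rightarrow> 'a) \<Rightarrow> (('a + 'm) list \<Rightarrow> 'm) \<Rightarrow> ('a + 'm) list \<Rightarrow> 'm" where
  "delta_Hoch_M n f g ws =
     (if length ws = n + 1 \<and> num_M ws = 1 then
        act (hd ws) (f_plus_g f g (tl ws))
        + (\<Sum>i = 1..n. sM ((-1) ^ i) (g (contract mu_act i ws)))
        + sM ((-1) ^ (n + 1)) (act (f_plus_g f g (butlast ws)) (last ws))
      else 0)"

fun diass :: "diass_op \<Rightarrow> 'm \<Rightarrow> 'm \<Rightarrow> 'm" where
  "diass Dashv u v = r u (P v)"
| "diass Vdash u v = l (P u) v"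

fun diass_left :: "diass_op \<Rightarrow> 'm \<Rightarrow> 'a \<Rightarrow> 'a" where
  "diass_left Dashv u a = mu (P u) a - P (r u a)"
| "diass_left Vdash u a = mu (P u) a"

fun diass_right :: "diass_op \<Rightarrow> 'a \<Rightarrow> 'm \<Rightarrow> 'a" where
  "diass_right Dashv a u = mu a (P u)"
| "diass_right Vdash a u = mu a (P u) - P (l a u)"

definition delta_Diass :: "nat \<Rightarrow> (ptree \<Rightarrow> 'm list \<Rightarrow> 'a) \<Rightarrow> ptree \<Rightarrow> 'm list \<Rightarrow> 'a" where
  "delta_Diass m \<gamma> y us =
     (if nodes y = m + 1 \<and> length us = m + 1 then
        diass_left (star 0 y) (hd us) (\<gamma> (delete_leaf 0 y) (tl us))
        + (\<Sum>i = 1..m. sA ((-1) ^ i) (\<gamma> (delete_leaf i y) (contract (diass (star i y)) i us)))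
        + sA ((-1) ^ (m + 1))
            (diass_right (star (m + 1) y) (\<gamma> (delete_leaf (m + 1) y) (butlast us)) (last us))
      else 0)"

definition h_P ::
  "nat \<Rightarrow> ('a list \<Rightarrow> 'a) \<Rightarrow> (('a + 'm) list \<Rightarrow> 'm) \<Rightarrow> ptree \<Rightarrow> 'm list \<Rightarrow> 'a" where
  "h_P n f g y us =
     (if nodes y = n \<and> length us = n then
        (case y of
           Leaf \<Rightarrow> 0
         | Graft y1 y2 \<Rightarrow>
             let i = nodes y1 + 1 in
             sA ((-1) ^ n)
               (f (map P us)
                - P (g (map (\<lambda>u. Inl (P u)) (take (i - 1) us) @ Inr (us ! (i - 1)) #
                        map (\<lambda>u. Inl (P u)) (drop i us)))))
      else 0)"

text \<open>
  The third component of an \<open>n\<close>-cochain has \<open>n - 1\<close> arguments.  For \<open>n = 1\<close> it is \<open>0\<close> and so is its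
  coboundary; the only \<open>0\<close>-cochain is \<open>0\<close>, with coboundary \<open>0\<close>.
\<close>

fun delta :: "nat \<Rightarrow> ('a, 'm) cochain \<Rightarrow> ('a, 'm) cochain" where
  "delta n (f, g, \<gamma>) = (delta_Hoch n f, delta_Hoch_M n f g, delta_Diass (n - 1) \<gamma> + h_P n f g)"

definition cocycles :: "nat \<Rightarrow> ('a, 'm) cochain set" where
  "cocycles n = {c \<in> cochains n. delta n c = 0}"

definition coboundaries :: "nat \<Rightarrow> ('a, 'm) cochain set" where
  "coboundaries n = (if n = 0 then {0} else delta (n - 1) ` cochains (n - 1))"

definition cohomology :: "nat \<Rightarrow> ('a, 'm) cochain set set" where
  "cohomology n =
     cocycles n // {(c, c'). c \<in> cocycles n \<and> c' \<in> cocycles n \<and> c - c' \<in> coboundaries n}"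

subsection \<open>Infinitesimal deformations\<close>

definition infinitesimal_deformations :: "('a \<times> 'a, 'm \<times> 'm) raa_ops set" where
  "infinitesimal_deformations =
     {(mut, lt, rt, Pt) | mut lt rt Pt.
        (\<exists>mu1 l1 r1 P1.
           bilinear_map sA sA sA mu1 \<and> bilinear_map sA sM sM l1 \<and> bilinear_map sM sA sM r1 \<and>
           module_hom sM sA P1 \<and>
           mut = bil_deform sA mu mu1 \<and> lt = bil_deform sM l l1 \<and> rt = bil_deform sM r r1 \<and>
           Pt = lin_deform sA P P1) \<and>
        rel_avg_algebra (ext_scale sA) (ext_scale sM) (mut, lt, rt, Pt)}"

definition deformation_equiv ::
  "('a \<times> 'a, 'm \<times> 'm) raa_ops \<Rightarrow> ('a \<times> 'a, 'm \<times> 'm) raa_ops \<Rightarrow> bool" where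
  "deformation_equiv D D' \<longleftrightarrow>
     (\<exists>\<phi>1 \<psi>1. module_hom sA sA \<phi>1 \<and> module_hom sM sM \<psi>1 \<and>
        rel_avg_isomorphism (ext_scale sA) (ext_scale sM) D (ext_scale sA) (ext_scale sM) D'
          (lin_deform sA id \<phi>1, lin_deform sM id \<psi>1))"

definition deformation_classes :: "('a \<times> 'a, 'm \<times> 'm) raa_ops set set" where
  "deformation_classes =
     infinitesimal_deformations //
       {(D, D'). D \<in> infinitesimal_deformations \<and> D' \<in> infinitesimal_deformations \<and>
                 deformation_equiv D D'}"

end

end

theory Submission
  imports Defs
begin

text \<open>
  Both sides are described by quadruples \<open>(\<mu>\<^sub>1, l\<^sub>1, r\<^sub>1, P\<^sub>1)\<close> of (bi)linear maps.  Since \<open>t\<^sup>2 = 0\<close>, such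
  a quadruple defines a deformation iff the coefficients of \<open>t\<close> in the axioms vanish.  On the other
  hand \<open>Y\<^sub>1\<close> has a single tree, so the quadruples are exactly the 2-cochains, with \<open>l\<^sub>1\<close> and \<open>r\<^sub>1\<close> the
  two components of \<open>g\<close> and \<open>P\<^sub>1 = \<gamma>\<close>, and the coefficient equations are the cocycle equations; the two
  trees of \<open>Y\<^sub>2\<close> account for the two averaging identities.  Likewise, the condition for
  \<open>(id + t \<phi>, id + t \<psi>)\<close> to be a morphism says that the difference of the two cochains is the
  coboundary of \<open>(\<phi>, \<psi>)\<close>.  Such a morphism has the inverse \<open>(id - t \<phi>, id - t \<psi>)\<close>.
\<close>

text \<open>\<open>image F\<close> sends the class of \<open>x\<close> under \<open>R\<close> to the
  class of \<open>F x\<close> under \<open>S\<close>, because \<open>F\<close> is onto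
  \<open>Y\<close> and carries \<open>R\<close> to \<open>S\<close>. It is injective on classes
  since these are subsets of \<open>X\<close>, where \<open>F\<close> is injective.\<close>

lemma bij_betw_quotients:
  assumes F: "bij_betw F X Y"
    and rel: "\<And>x x'. x \<in> X \<Longrightarrow> x' \<in> X \<Longrightarrow> R x x' \<longleftrightarrow> S (F x) (F x')"
  shows "bij_betw (image F) (X // {(x, x'). x \<in> X \<and> x' \<in> X \<and> R x x'})
           (Y // {(y, y'). y \<in> Y \<and> y' \<in> Y \<and> S y y'})"
    (is "bij_betw _ (X // ?R) (Y // ?S)")
proof -
  have inj: "inj_on F X" and Y: "Y = F ` X"
    using F by (auto simp: bij_betw_def)
  have cls: "F ` (?R `` {x}) = ?S `` {F x}" if "x \<in> X" for x
    using that rel by (auto simp: Y)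
  have "inj_on (image F) (Pow X)"
    using inj by (rule inj_on_image_Pow)
  then have "inj_on (image F) (X // ?R)"
    by (rule inj_on_subset) (auto simp: quotient_def)
  moreover have "image F ` (X // ?R) = Y // ?S"
  proof -
    have "image F ` (X // ?R) = (\<lambda>x. F ` (?R `` {x})) ` X"
      by (auto simp: quotient_def)
    also have "\<dots> = (\<lambda>x. ?S `` {F x}) ` X"
      by (intro image_cong refl cls)
    also have "\<dots> = Y // ?S"
      by (auto simp: quotient_def Y)
    finally show ?thesis .
  qed
  ultimately show ?thesis by (simp add: bij_betw_def)
qed

section \<open>Linear and bilinear maps of the form \<open>f + t f1\<close>\<close>

lemma bilinear_map_iff:
  "bilinear_map s1 s2 s3 f \<longleftrightarrow>
     module s1 \<and> module s2 \<and> module s3 \<and>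
     (\<forall>x y z. f (x + y) z = f x z + f y z) \<and> (\<forall>x y z. f x (y + z) = f x y + f x z) \<and>
     (\<forall>c x y. f (s1 c x) y = s3 c (f x y)) \<and> (\<forall>c x y. f x (s2 c y) = s3 c (f x y))"
  unfolding bilinear_map_def module_hom_def module_hom_axioms_def by blast

lemma module_hom_iff_linear:
  "module_hom s1 s2 f \<longleftrightarrow>
     module s1 \<and> module s2 \<and> (\<forall>x y. f (x + y) = f x + f y) \<and> (\<forall>c x. f (s1 c x) = s2 c (f x))"
  unfolding module_hom_def module_hom_axioms_def by blast

lemma bilinear_map_zero:
  assumes "bilinear_map s1 s2 s3 f"
  shows "f 0 y = 0" "f x 0 = 0"
  using assms unfolding bilinear_map_def by (auto dest: module_hom.zero)

lemma bilinear_map_diff: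
  assumes "bilinear_map s1 s2 s3 f"
  shows "f (x - x') y = f x y - f x' y" "f x (y - y') = f x y - f x y'"
  using assms unfolding bilinear_map_def by (auto dest: module_hom.diff)

text \<open>Multiplication by \<open>dual_t\<close> turns \<open>(a, b)\<close> into
  \<open>(0, a)\<close>, so \<open>f1\<close> enters the coefficient of \<open>t\<close> only and
  sees only the constant terms of its arguments.\<close>

lemma bil_deform_apply:
  assumes "module s"
  shows "bil_deform s f f1 p q =
    (f (fst p) (fst q), f (fst p) (snd q) + f (snd p) (fst q) + f1 (fst p) (fst q))"
proof -
  interpret module s by fact
  show ?thesis by (simp add: bil_deform_def ext_bil_def ext_scale_def)
qed

lemma lin_deform_apply:
  assumes "module s"
  shows "lin_deform s f f1 p = (f (fst p), f (snd p) + f1 (fst p))"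
proof -
  interpret module s by fact
  show ?thesis by (simp add: lin_deform_def ext_lin_def ext_scale_def)
qed

lemma bilinear_map_bil_deform:
  assumes f: "bilinear_map s1 s2 s3 f" and f1: "bilinear_map s1 s2 s3 f1"
  shows "bilinear_map (ext_scale s1) (ext_scale s2) (ext_scale s3) (bil_deform s3 f f1)"
proof -
  interpret m1: module s1 using f by (simp add: bilinear_map_iff)
  interpret m2: module s2 using f by (simp add: bilinear_map_iff)
  interpret m3: module s3 using f by (simp add: bilinear_map_iff)
  note [simp] = m3.scale_right_distrib
  show ?thesis
    using f f1 unfolding bilinear_map_iff
    by (simp add: module_ext_scale bil_deform_apply ext_scale_def add_ac mult.commute)
qed

lemma module_hom_lin_deform:
  assumes f: "module_hom s1 s2 f" and f1: "module_hom s1 s2 f1"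
  shows "module_hom (ext_scale s1) (ext_scale s2) (lin_deform s2 f f1)"
proof -
  interpret m1: module s1 using f by (simp add: module_hom_iff_linear)
  interpret m2: module s2 using f by (simp add: module_hom_iff_linear)
  note [simp] = m2.scale_right_distrib
  show ?thesis
    using f f1 unfolding module_hom_iff_linear
    by (simp add: module_ext_scale lin_deform_apply ext_scale_def add_ac)
qed

text \<open>The first-order term is recovered from the coefficient of \<open>t\<close> at
  \<open>(x, 0)\<close> and \<open>(y, 0)\<close>, where the contributions of \<open>f\<close> agree
  on both sides.\<close>

lemma bil_deform_eq_iff:
  assumes f: "bilinear_map s1 s2 s3 f" and f1: "bilinear_map s1 s2 s3 f1"
    and f1': "bilinear_map s1 s2 s3 f1'"
  shows "bil_deform s3 f f1 = bil_deform s3 f f1' \<longleftrightarrow> f1 = f1'"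
proof
  assume eq: "bil_deform s3 f f1 = bil_deform s3 f f1'"
  have "module s3" using f by (simp add: bilinear_map_iff)
  then have "f1 x y = f1' x y" for x y
    using fun_cong[OF fun_cong[OF eq, of "(x, 0)"], of "(y, 0)"]
    by (simp add: bil_deform_apply)
  then show "f1 = f1'" by (intro ext)
qed simp

lemma lin_deform_eq_iff:
  fixes f :: "'a::zero \<Rightarrow> 'b::ab_group_add"
  assumes "module s"
  shows "lin_deform s f f1 = lin_deform s f f1' \<longleftrightarrow> f1 = f1'"
proof
  assume eq: "lin_deform s f f1 = lin_deform s f f1'"
  have "f1 x = f1' x" for x
    using fun_cong[OF eq, of "(x, 0)"] by (simp add: lin_deform_apply assms)
  then show "f1 = f1'" by (intro ext)
qed simp

section \<open>Small trees, short lists and multilinear maps of low degree\<close>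

lemma nodes_eq_0_iff [simp]: "nodes y = 0 \<longleftrightarrow> y = Leaf"
  by (cases y) auto

lemma nodes_eq_1_iff: "nodes y = Suc 0 \<longleftrightarrow> y = Graft Leaf Leaf"
  by (cases y) auto

lemma nodes_eq_2_iff:
  "nodes y = Suc (Suc 0) \<longleftrightarrow>
     y = Graft Leaf (Graft Leaf Leaf) \<or> y = Graft (Graft Leaf Leaf) Leaf"
  by (cases y) (auto simp: add_is_1 nodes_eq_1_iff)

lemma length_eq_2_iff: "length xs = 2 \<longleftrightarrow> (\<exists>a b. xs = [a, b])"
  by (auto simp: numeral_2_eq_2 length_Suc_conv)

lemma length_eq_3_iff: "length xs = 3 \<longleftrightarrow> (\<exists>a b c. xs = [a, b, c])"
  by (auto simp: numeral_3_eq_3 length_Suc_conv)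

lemma multilinear_1_iff:
  "multilinear sV sW (Suc 0) f \<longleftrightarrow>
     (\<forall>xs. length xs \<noteq> 1 \<longrightarrow> f xs = 0) \<and> module_hom sV sW (\<lambda>a. f [a])"
  by (auto simp: multilinear_def)

lemma multilinear_2_iff:
  fixes sV :: "'k::comm_ring_1 \<Rightarrow> 'v::ab_group_add \<Rightarrow> 'v"
  shows "multilinear sV sW 2 f \<longleftrightarrow>
     (\<forall>xs. length xs \<noteq> 2 \<longrightarrow> f xs = 0) \<and> bilinear_map sV sV sW (\<lambda>a b. f [a, b])"
proof -
  \<comment> \<open>In a list of two entries, the entry that stays fixed lies to the right or to the
    left of the varied one; these are the two linearity conditions of a bilinear map.\<close>
  have split: "(\<forall>xs ys. length xs + 1 + length ys = 2 \<longrightarrow> Q xs ys) \<longleftrightarrow>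
      (\<forall>b. Q [] [b]) \<and> (\<forall>a. Q [a] [])" for Q :: "'v list \<Rightarrow> 'v list \<Rightarrow> bool"
    by (auto simp: add_is_1 length_Suc_conv)
  show ?thesis
    unfolding multilinear_def split bilinear_map_def by auto
qed

text \<open>Cochains and coboundaries are normalised to 0 on lists of the wrong length, so an
  equation between them only has to be tested on lists of the right length.\<close>

lemma fun_eq_on_lists_2_iff:
  assumes "\<And>xs. length xs \<noteq> 2 \<Longrightarrow> F xs = G xs"
  shows "F = G \<longleftrightarrow> (\<forall>a b. F [a, b] = G [a, b])"
  using assms by (metis ext length_eq_2_iff)

lemma fun_eq_on_lists_3_iff:
  assumes "\<And>xs. length xs \<noteq> 3 \<Longrightarrow> F xs = G xs"
  shows "F = G \<longleftrightarrow> (\<forall>a b c. F [a, b, c] = G [a, b, c])"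
  using assms by (metis ext length_eq_3_iff)

lemma sum_1_2: "(\<Sum>i = Suc 0..2. h i) = h (Suc 0) + h 2"
  by (simp add: numeral_2_eq_2)

text \<open>The Hochschild coboundary of a 2-cochain has the form \<open>x - y + z - w\<close>; its
  vanishing becomes an equation between sums, as in \<open>first_order\<close>.\<close>

lemma alternating_sum_eq_iff:
  "x - y + z = w \<longleftrightarrow> y + w = z + (x::'a::ab_group_add)"
  by (auto simp: algebra_simps)

lemma num_M_simps [simp]:
  "num_M [] = 0" "num_M (Inl a # ws) = num_M ws" "num_M (Inr u # ws) = Suc (num_M ws)"
  "num_M (ws @ vs) = num_M ws + num_M vs"
  by (simp_all add: num_M_def)

lemma mixed_multilinear_1_iff:
  "mixed_multilinear sA sM (Suc 0) g \<longleftrightarrow>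
     (\<forall>ws. \<not> (length ws = 1 \<and> num_M ws = 1) \<longrightarrow> g ws = 0) \<and> module_hom sM sM (\<lambda>u. g [Inr u])"
  by (auto simp: mixed_multilinear_def)

lemma mixed_multilinear_2_iff:
  fixes sA :: "'k::comm_ring_1 \<Rightarrow> 'a::ab_group_add \<Rightarrow> 'a"
    and sM :: "'k \<Rightarrow> 'm::ab_group_add \<Rightarrow> 'm"
  shows "mixed_multilinear sA sM 2 g \<longleftrightarrow>
     (\<forall>ws. \<not> (length ws = 2 \<and> num_M ws = 1) \<longrightarrow> g ws = 0) \<and>
     bilinear_map sA sM sM (\<lambda>a u. g [Inl a, Inr u]) \<and>
     bilinear_map sM sA sM (\<lambda>u a. g [Inr u, Inl a])"
proof -
  \<comment> \<open>\<open>n\<close> counts the entries from \<open>M\<close> outside the varied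
    slot: 1 if that slot lies in \<open>A\<close>, 0 if it lies in \<open>M\<close>. Together the
    two cases give linearity in both variables for both types of words.\<close>
  have split: "(\<forall>ws vs. length ws + 1 + length vs = 2 \<and> num_M (ws @ vs) = n \<longrightarrow> Q ws vs) \<longleftrightarrow>
      (\<forall>b. num_M [b] = n \<longrightarrow> Q [] [b]) \<and> (\<forall>a. num_M [a] = n \<longrightarrow> Q [a] [])"
    for Q :: "('a + 'm) list \<Rightarrow> ('a + 'm) list \<Rightarrow> bool" and n
    by (auto simp: add_is_1 length_Suc_conv)
  show ?thesis
    unfolding mixed_multilinear_def split bilinear_map_def by (auto simp: split_sum_all)
qed

text \<open>This and the next three definitions turn linear and bilinear maps into components of
  cochains; the default value 0 is the normalisation required by \<open>multilinear\<close> and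
  \<open>mixed_multilinear\<close>.\<close>

definition unary_on_lists :: "('v \<Rightarrow> 'w::zero) \<Rightarrow> 'v list \<Rightarrow> 'w" where
  "unary_on_lists F xs = (case xs of [a] \<Rightarrow> F a | _ \<Rightarrow> 0)"

definition binary_on_lists :: "('v \<Rightarrow> 'v \<Rightarrow> 'w::zero) \<Rightarrow> 'v list \<Rightarrow> 'w" where
  "binary_on_lists F xs = (case xs of [a, b] \<Rightarrow> F a b | _ \<Rightarrow> 0)"

definition unary_on_words :: "('m \<Rightarrow> 'w::zero) \<Rightarrow> ('a + 'm) list \<Rightarrow> 'w" where
  "unary_on_words F ws = (case ws of [Inr u] \<Rightarrow> F u | _ \<Rightarrow> 0)"

definition binary_on_words ::
  "('a \<Rightarrow> 'm \<Rightarrow> 'w::zero) \<Rightarrow> ('m \<Rightarrow> 'a \<Rightarrow> 'w) \<Rightarrow> ('a + 'm) list \<Rightarrow> 'w" where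
  "binary_on_words F G ws =
     (case ws of [Inl a, Inr u] \<Rightarrow> F a u | [Inr u, Inl a] \<Rightarrow> G u a | _ \<Rightarrow> 0)"

lemma on_lists_apply [simp]:
  "unary_on_lists F [a] = F a"
  "binary_on_lists B [a, b] = B a b"
  "unary_on_words H [Inr u] = H u"
  "binary_on_words L R [Inl x, Inr u] = L x u"
  "binary_on_words L R [Inr u, Inl x] = R u x"
  by (simp_all add: unary_on_lists_def binary_on_lists_def unary_on_words_def binary_on_words_def)

lemma unary_on_lists_zero: "length xs \<noteq> Suc 0 \<Longrightarrow> unary_on_lists F xs = 0"
  by (auto simp: unary_on_lists_def split: list.split)

lemma binary_on_lists_zero: "length xs \<noteq> 2 \<Longrightarrow> binary_on_lists F xs = 0"
  by (auto simp: binary_on_lists_def split: list.split)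

lemma unary_on_words_zero:
  "length ws = Suc 0 \<longrightarrow> num_M ws \<noteq> Suc 0 \<Longrightarrow> unary_on_words F ws = 0"
  by (auto simp: unary_on_words_def split: list.split sum.split)

lemma binary_on_words_zero:
  "length ws = 2 \<longrightarrow> num_M ws \<noteq> Suc 0 \<Longrightarrow> binary_on_words F G ws = 0"
  by (auto simp: binary_on_words_def split: list.split sum.split)

lemma unary_on_lists_eq:
  "\<forall>xs. length xs \<noteq> Suc 0 \<longrightarrow> f xs = 0 \<Longrightarrow> unary_on_lists (\<lambda>a. f [a]) xs = f xs"
  by (auto simp: unary_on_lists_def split: list.split)

lemma binary_on_lists_eq:
  "\<forall>xs. length xs \<noteq> 2 \<longrightarrow> f xs = 0 \<Longrightarrow> binary_on_lists (\<lambda>a b. f [a, b]) xs = f xs"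
  by (auto simp: binary_on_lists_def split: list.split)

lemma binary_on_words_eq:
  "\<forall>ws. (length ws = 2 \<longrightarrow> num_M ws \<noteq> Suc 0) \<longrightarrow> g ws = 0 \<Longrightarrow>
   binary_on_words (\<lambda>a u. g [Inl a, Inr u]) (\<lambda>u a. g [Inr u, Inl a]) ws = g ws"
  by (auto simp: binary_on_words_def split: list.split sum.split)

section \<open>First-order data of a relative averaging algebra\<close>

locale relative_averaging = rel_avg sA mu sM l r P
  for sA :: "'k::field_char_0 \<Rightarrow> 'a::ab_group_add \<Rightarrow> 'a"
    and mu :: "'a \<Rightarrow> 'a \<Rightarrow> 'a"
    and sM :: "'k \<Rightarrow> 'm::ab_group_add \<Rightarrow> 'm"
    and l :: "'a \<Rightarrow> 'm \<Rightarrow> 'm"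
    and r :: "'m \<Rightarrow> 'a \<Rightarrow> 'm"
    and P :: "'m \<Rightarrow> 'a" +
  assumes alg: "assoc_algebra sA mu"
    and bimod: "bimodule sA mu sM l r"
    and avg: "relative_averaging_operator sA mu sM l r P"
begin

sublocale A: module sA using alg by (simp add: assoc_algebra_def)
sublocale M: module sM using bimod by (simp add: bimodule_def)
sublocale P: module_hom sM sA P using avg by (simp add: relative_averaging_operator_def)

lemma bilinear: "bilinear_map sA sA sA mu" "bilinear_map sA sM sM l" "bilinear_map sM sA sM r"
  using alg bimod by (simp_all add: assoc_algebra_def bimodule_def)

lemma assoc:
  "mu (mu a b) c = mu a (mu b c)" "l (mu a b) u = l a (l b u)"
  "r (l a u) b = l a (r u b)" "r (r u a) b = r u (mu a b)"
  using alg bimod by (simp_all add: assoc_algebra_def bimodule_def)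

lemma averaging: "P (l (P u) v) = mu (P u) (P v)" "P (r u (P v)) = mu (P u) (P v)"
  using avg unfolding relative_averaging_operator_def by metis+

text \<open>Evaluating deformed operations at \<open>(a, 0)\<close> leaves terms with an argument 0,
  which these rules remove.\<close>

lemmas ops_zero [simp] = bilinear[THEN bilinear_map_zero(1)] bilinear[THEN bilinear_map_zero(2)]
lemmas ops_diff = bilinear[THEN bilinear_map_diff(1)] bilinear[THEN bilinear_map_diff(2)]

lemma ops_add:
  "mu (a + a') b = mu a b + mu a' b" "mu a (b + b') = mu a b + mu a b'"
  "l (a + a') u = l a u + l a' u" "l a (u + u') = l a u + l a u'"
  "r (u + u') a = r u a + r u' a" "r u (a + a') = r u a + r u a'"
  using bilinear by (simp_all add: bilinear_map_iff)

definition bilinear_quadruple :: "('a, 'm) raa_ops \<Rightarrow> bool" where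
  "bilinear_quadruple = (\<lambda>(mu1, l1, r1, P1).
     bilinear_map sA sA sA mu1 \<and> bilinear_map sA sM sM l1 \<and> bilinear_map sM sA sM r1 \<and>
     module_hom sM sA P1)"

text \<open>The coefficients of \<open>t\<close> in the axioms of a relative averaging algebra.\<close>

definition first_order :: "('a, 'm) raa_ops \<Rightarrow> bool" where
  "first_order = (\<lambda>(mu1, l1, r1, P1).
     (\<forall>a b c. mu1 (mu a b) c + mu (mu1 a b) c = mu1 a (mu b c) + mu a (mu1 b c)) \<and>
     (\<forall>a b u. l1 (mu a b) u + l (mu1 a b) u = l1 a (l b u) + l a (l1 b u)) \<and>
     (\<forall>a u b. r1 (l a u) b + r (l1 a u) b = l1 a (r u b) + l a (r1 u b)) \<and>
     (\<forall>u a b. r1 (r u a) b + r (r1 u a) b = r1 u (mu a b) + r u (mu1 a b)) \<and>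
     (\<forall>u v. P1 (l (P u) v) + P (l1 (P u) v) + P (l (P1 u) v) =
            mu1 (P u) (P v) + mu (P1 u) (P v) + mu (P u) (P1 v)) \<and>
     (\<forall>u v. P1 (r u (P v)) + P (r1 u (P v)) + P (r u (P1 v)) =
            mu1 (P u) (P v) + mu (P1 u) (P v) + mu (P u) (P1 v)))"

text \<open>The coefficients of \<open>t\<close> in the axioms of a morphism \<open>(id + t \<phi>, id + t \<psi>)\<close>.\<close>

definition first_order_morphism ::
  "('a, 'm) raa_ops \<Rightarrow> ('a, 'm) raa_ops \<Rightarrow> ('a \<Rightarrow> 'a) \<Rightarrow> ('m \<Rightarrow> 'm) \<Rightarrow> bool" where
  "first_order_morphism = (\<lambda>(mu1, l1, r1, P1) (mu2, l2, r2, P2) \<phi> \<psi>.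
     module_hom sA sA \<phi> \<and> module_hom sM sM \<psi> \<and>
     (\<forall>a b. mu1 a b + \<phi> (mu a b) = mu2 a b + mu a (\<phi> b) + mu (\<phi> a) b) \<and>
     (\<forall>a u. l1 a u + \<psi> (l a u) = l2 a u + l a (\<psi> u) + l (\<phi> a) u) \<and>
     (\<forall>u a. r1 u a + \<psi> (r u a) = r2 u a + r u (\<phi> a) + r (\<psi> u) a) \<and>
     (\<forall>u. P1 u + \<phi> (P u) = P2 u + P (\<psi> u)))"

subsection \<open>Deformations\<close>

definition deform :: "('a, 'm) raa_ops \<Rightarrow> ('a \<times> 'a, 'm \<times> 'm) raa_ops" where
  "deform = (\<lambda>(mu1, l1, r1, P1).
     (bil_deform sA mu mu1, bil_deform sM l l1, bil_deform sM r r1, lin_deform sA P P1))"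

lemmas deform_apply =
  bil_deform_apply[OF A.module_axioms] bil_deform_apply[OF M.module_axioms]
  lin_deform_apply[OF A.module_axioms] lin_deform_apply[OF M.module_axioms]

lemma rel_avg_algebra_deform_iff:
  assumes q: "bilinear_quadruple q"
  shows "rel_avg_algebra (ext_scale sA) (ext_scale sM) (deform q) \<longleftrightarrow> first_order q"
proof -
  obtain mu1 l1 r1 P1 where q_eq: "q = (mu1, l1, r1, P1)" by (cases q)
  have bil: "bilinear_map sA sA sA mu1" "bilinear_map sA sM sM l1" "bilinear_map sM sA sM r1"
    and P1: "module_hom sM sA P1"
    using q by (auto simp: q_eq bilinear_quadruple_def)
  note [simp] = bil[THEN bilinear_map_zero(1)] bil[THEN bilinear_map_zero(2)] module_hom.zero[OF P1]
  have lin: "bilinear_map (ext_scale sA) (ext_scale sA) (ext_scale sA) (bil_deform sA mu mu1)"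
    "bilinear_map (ext_scale sA) (ext_scale sM) (ext_scale sM) (bil_deform sM l l1)"
    "bilinear_map (ext_scale sM) (ext_scale sA) (ext_scale sM) (bil_deform sM r r1)"
    "module_hom (ext_scale sM) (ext_scale sA) (lin_deform sA P P1)"
    "module (ext_scale sA)" "module (ext_scale sM)"
    using bilinear bil P1 P.module_hom_axioms
    by (auto intro: bilinear_map_bil_deform module_hom_lin_deform module_ext_scale
        A.module_axioms M.module_axioms)
  show ?thesis
  proof
    assume "rel_avg_algebra (ext_scale sA) (ext_scale sM) (deform q)"
    \<comment> \<open>Arguments without a \<open>t\<close> part suffice: there the coefficient of
      \<open>t\<close> in each axiom is one equation of \<open>first_order\<close>.\<close>
    then have D:
      "\<And>a b c. bil_deform sA mu mu1 (bil_deform sA mu mu1 (a, 0) (b, 0)) (c, 0) =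
         bil_deform sA mu mu1 (a, 0) (bil_deform sA mu mu1 (b, 0) (c, 0))"
      "\<And>a b u. bil_deform sM l l1 (bil_deform sA mu mu1 (a, 0) (b, 0)) (u, 0) =
         bil_deform sM l l1 (a, 0) (bil_deform sM l l1 (b, 0) (u, 0))"
      "\<And>a u b. bil_deform sM r r1 (bil_deform sM l l1 (a, 0) (u, 0)) (b, 0) =
         bil_deform sM l l1 (a, 0) (bil_deform sM r r1 (u, 0) (b, 0))"
      "\<And>u a b. bil_deform sM r r1 (bil_deform sM r r1 (u, 0) (a, 0)) (b, 0) =
         bil_deform sM r r1 (u, 0) (bil_deform sA mu mu1 (a, 0) (b, 0))"
      "\<And>u v. bil_deform sA mu mu1 (lin_deform sA P P1 (u, 0)) (lin_deform sA P P1 (v, 0)) =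
         lin_deform sA P P1 (bil_deform sM l l1 (lin_deform sA P P1 (u, 0)) (v, 0))"
      "\<And>u v. bil_deform sA mu mu1 (lin_deform sA P P1 (u, 0)) (lin_deform sA P P1 (v, 0)) =
         lin_deform sA P P1 (bil_deform sM r r1 (u, 0) (lin_deform sA P P1 (v, 0)))"
      unfolding q_eq deform_def prod.case rel_avg_algebra.simps assoc_algebra_def bimodule_def
        relative_averaging_operator_def by blast+
    show "first_order q"
      using D by (simp add: q_eq first_order_def deform_apply P.add P.zero add_ac)
  next
    assume fo: "first_order q"
    then have fo':
      "mu1 (mu a b) c + mu (mu1 a b) c = mu1 a (mu b c) + mu a (mu1 b c)"
      "l1 (mu a b) u + l (mu1 a b) u = l1 a (l b u) + l a (l1 b u)"
      "r1 (l a u) b + r (l1 a u) b = l1 a (r u b) + l a (r1 u b)"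
      "r1 (r u a) b + r (r1 u a) b = r1 u (mu a b) + r u (mu1 a b)"
      "P1 (l (P u) v) + P (l1 (P u) v) + P (l (P1 u) v) =
         mu1 (P u) (P v) + mu (P1 u) (P v) + mu (P u) (P1 v)"
      "P1 (r u (P v)) + P (r1 u (P v)) + P (r u (P1 v)) =
         mu1 (P u) (P v) + mu (P1 u) (P v) + mu (P u) (P1 v)" for a b c u v
      unfolding q_eq first_order_def prod.case by blast+
    \<comment> \<open>The first components are the original axioms. In the second components, the
      terms containing the \<open>t\<close> part of an argument cancel by the original axioms, and
      the rest is the equation of \<open>first_order\<close> at the constant terms.\<close>
    show "rel_avg_algebra (ext_scale sA) (ext_scale sM) (deform q)"
      unfolding q_eq deform_def prod.case rel_avg_algebra.simps assoc_algebra_def bimodule_def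
        relative_averaging_operator_def
      using lin fo'
      by (simp add: deform_apply P.add ops_add assoc averaging algebra_simps)
  qed
qed

text \<open>As the leading terms are identities, both sides of each morphism equation have the same
  constant term, and the contributions of the \<open>t\<close> parts of the arguments cancel in the
  coefficient of \<open>t\<close>.\<close>

lemma rel_avg_morphism_deform_iff:
  assumes "bilinear_quadruple q" "bilinear_quadruple q'"
    and hom: "module_hom sA sA \<phi>" "module_hom sM sM \<psi>"
  shows "rel_avg_morphism (ext_scale sA) (ext_scale sM) (deform q)
           (ext_scale sA) (ext_scale sM) (deform q') (lin_deform sA id \<phi>, lin_deform sM id \<psi>) \<longleftrightarrow>
         first_order_morphism q q' \<phi> \<psi>"
proof -
  obtain mu1 l1 r1 P1 where q_eq: "q = (mu1, l1, r1, P1)" by (cases q)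
  obtain mu2 l2 r2 P2 where q'_eq: "q' = (mu2, l2, r2, P2)" by (cases q')
  interpret \<phi>: module_hom sA sA \<phi> by fact
  interpret \<psi>: module_hom sM sM \<psi> by fact
  have "module_hom (ext_scale sA) (ext_scale sA) (lin_deform sA id \<phi>)"
    "module_hom (ext_scale sM) (ext_scale sM) (lin_deform sM id \<psi>)"
    using hom A.module_hom_id M.module_hom_id by (auto intro: module_hom_lin_deform)
  then show ?thesis
    unfolding q_eq q'_eq deform_def prod.case rel_avg_morphism.simps first_order_morphism_def
    by (auto simp: hom deform_apply split_paired_all \<phi>.add \<psi>.add P.add ops_add algebra_simps)
qed

text \<open>The equations are linear in the difference of \<open>q\<close> and \<open>q'\<close>
  together with \<open>\<phi>\<close> and \<open>\<psi>\<close>. Exchanging \<open>q\<close> and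
  \<open>q'\<close> changes the sign of the difference, which negating both maps
  compensates.\<close>

lemma first_order_morphism_inverse:
  assumes "first_order_morphism q q' \<phi> \<psi>"
  shows "first_order_morphism q' q (\<lambda>a. - \<phi> a) (\<lambda>u. - \<psi> u)"
proof -
  have "mu a (- b) = - mu a b" "mu (- a) b = - mu a b" "l a (- u) = - l a u"
    "l (- a) u = - l a u" "r u (- a) = - r u a" "r (- u) a = - r u a" for a b u
    using ops_diff(1)[of 0] ops_diff(2)[of 0]
      ops_diff(3)[of 0] ops_diff(4)[of _ 0] ops_diff(5)[of _ 0] ops_diff(6)[of _ 0] by simp_all
  then show ?thesis
    using assms
    by (auto simp: first_order_morphism_def module_hom_iff_linear A.scale_minus_right
        M.scale_minus_right P.neg algebra_simps split: prod.splits)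
qed

lemma deformation_equiv_deform_iff:
  assumes q: "bilinear_quadruple q" "bilinear_quadruple q'"
  shows "deformation_equiv (deform q) (deform q') \<longleftrightarrow> (\<exists>\<phi> \<psi>. first_order_morphism q q' \<phi> \<psi>)"
proof
  assume "deformation_equiv (deform q) (deform q')"
  then obtain \<phi> \<psi> where "module_hom sA sA \<phi>" "module_hom sM sM \<psi>"
    "rel_avg_morphism (ext_scale sA) (ext_scale sM) (deform q)
       (ext_scale sA) (ext_scale sM) (deform q') (lin_deform sA id \<phi>, lin_deform sM id \<psi>)"
    unfolding deformation_equiv_def by auto
  then show "\<exists>\<phi> \<psi>. first_order_morphism q q' \<phi> \<psi>"
    using rel_avg_morphism_deform_iff[OF q] by blast
next
  assume "\<exists>\<phi> \<psi>. first_order_morphism q q' \<phi> \<psi>"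
  then obtain \<phi> \<psi> where fwd: "first_order_morphism q q' \<phi> \<psi>" by blast
  note bwd = first_order_morphism_inverse[OF fwd]
  have hom: "module_hom sA sA \<phi>" "module_hom sM sM \<psi>"
    "module_hom sA sA (\<lambda>a. - \<phi> a)" "module_hom sM sM (\<lambda>u. - \<psi> u)"
    using fwd bwd by (auto simp: first_order_morphism_def split: prod.splits)
  have "rel_avg_isomorphism (ext_scale sA) (ext_scale sM) (deform q)
     (ext_scale sA) (ext_scale sM) (deform q') (lin_deform sA id \<phi>, lin_deform sM id \<psi>)"
    unfolding rel_avg_isomorphism.simps
  proof (intro conjI exI)
    show "rel_avg_morphism (ext_scale sA) (ext_scale sM) (deform q)
       (ext_scale sA) (ext_scale sM) (deform q') (lin_deform sA id \<phi>, lin_deform sM id \<psi>)"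
      using fwd rel_avg_morphism_deform_iff[OF q hom(1,2)] by blast
    show "rel_avg_morphism (ext_scale sA) (ext_scale sM) (deform q')
       (ext_scale sA) (ext_scale sM) (deform q)
       (lin_deform sA id (\<lambda>a. - \<phi> a), lin_deform sM id (\<lambda>u. - \<psi> u))"
      using bwd rel_avg_morphism_deform_iff[OF q(2,1) hom(3,4)] by blast
  \<comment> \<open>Left are the four composites: in the coefficient of \<open>t\<close>, the terms
    from \<open>\<phi>\<close> and \<open>- \<phi>\<close> cancel, and likewise for
    \<open>\<psi>\<close>.\<close>
  qed (auto simp: fun_eq_iff deform_apply)
  then show "deformation_equiv (deform q) (deform q')"
    using hom unfolding deformation_equiv_def by blast
qed

text \<open>A deformation is a tuple of maps on pairs that does not record its first-order terms.
  Injectivity says that it determines them; surjectivity comes from the existential in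
  \<open>infinitesimal_deformations\<close>.\<close>

lemma bij_betw_deform:
  "bij_betw deform {q. bilinear_quadruple q \<and> first_order q} infinitesimal_deformations"
proof (rule bij_betwI')
  fix q q' assume "q \<in> {q. bilinear_quadruple q \<and> first_order q}"
    "q' \<in> {q. bilinear_quadruple q \<and> first_order q}"
  then show "deform q = deform q' \<longleftrightarrow> q = q'"
    by (auto simp: deform_def bilinear_quadruple_def lin_deform_eq_iff A.module_axioms
        bil_deform_eq_iff[OF bilinear(1)] bil_deform_eq_iff[OF bilinear(2)]
        bil_deform_eq_iff[OF bilinear(3)] split: prod.splits)
next
  fix q assume q: "q \<in> {q. bilinear_quadruple q \<and> first_order q}"
  then have "rel_avg_algebra (ext_scale sA) (ext_scale sM) (deform q)"
    using rel_avg_algebra_deform_iff by blast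
  with q show "deform q \<in> infinitesimal_deformations"
    unfolding infinitesimal_deformations_def
    by (cases q) (auto simp: deform_def bilinear_quadruple_def simp del: rel_avg_algebra.simps)
next
  fix D assume "D \<in> infinitesimal_deformations"
  then obtain q where "bilinear_quadruple q" "D = deform q"
    "rel_avg_algebra (ext_scale sA) (ext_scale sM) (deform q)"
    unfolding infinitesimal_deformations_def deform_def bilinear_quadruple_def
    by (auto simp del: rel_avg_algebra.simps)
  then show "\<exists>q \<in> {q. bilinear_quadruple q \<and> first_order q}. D = deform q"
    using rel_avg_algebra_deform_iff by blast
qed

subsection \<open>Cochains\<close>

text \<open>The third component is 0 off the single tree of \<open>Y_1\<close>, as
  \<open>cochains 2\<close> demands for trees with another number of nodes.\<close>

definition cochain :: "('a, 'm) raa_ops \<Rightarrow> ('a, 'm) cochain" where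
  "cochain = (\<lambda>(mu1, l1, r1, P1).
     (binary_on_lists mu1, binary_on_words l1 r1,
      \<lambda>y. if y = Graft Leaf Leaf then unary_on_lists P1 else 0))"

lemma bij_betw_cochain: "bij_betw cochain {q. bilinear_quadruple q} (cochains 2)"
proof (rule bij_betw_byWitness)
  \<comment> \<open>The inverse evaluates each component at the arguments which the normalisation
    leaves free.\<close>
  let ?inv = "\<lambda>(f, g, \<gamma>). (\<lambda>a b. f [a, b], \<lambda>a u. g [Inl a, Inr u], \<lambda>u a. g [Inr u, Inl a],
    \<lambda>u. \<gamma> (Graft Leaf Leaf) [u])"
  have mem: "(f, g, \<gamma>) \<in> cochains 2 \<longleftrightarrow> multilinear sA sA 2 f \<and> mixed_multilinear sA sM 2 g \<and>
    multilinear sM sA (Suc 0) (\<gamma> (Graft Leaf Leaf)) \<and> (\<forall>y. y \<noteq> Graft Leaf Leaf \<longrightarrow> \<gamma> y = 0)"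
    for f g \<gamma>
    by (auto simp: cochains_def nodes_eq_1_iff)
  show "\<forall>q \<in> {q. bilinear_quadruple q}. ?inv (cochain q) = q"
    by (auto simp: cochain_def)
  show "\<forall>c \<in> cochains 2. cochain (?inv c) = c"
    by (auto simp: mem cochain_def multilinear_1_iff multilinear_2_iff mixed_multilinear_2_iff
        fun_eq_iff unary_on_lists_eq binary_on_lists_eq binary_on_words_eq)
  show "cochain ` {q. bilinear_quadruple q} \<subseteq> cochains 2"
    by (auto simp: mem cochain_def bilinear_quadruple_def multilinear_1_iff multilinear_2_iff
        mixed_multilinear_2_iff unary_on_lists_zero binary_on_lists_zero binary_on_words_zero)
  show "?inv ` cochains 2 \<subseteq> {q. bilinear_quadruple q}"
    by (auto simp: mem bilinear_quadruple_def multilinear_1_iff multilinear_2_iff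
        mixed_multilinear_2_iff)
qed

section \<open>Cocycles and coboundaries in degree 2\<close>

lemma delta_Hoch_off: "length as \<noteq> n + 1 \<Longrightarrow> delta_Hoch n f as = 0"
  by (simp add: delta_Hoch_def)

lemma delta_Hoch_M_off: "length ws = n + 1 \<longrightarrow> num_M ws \<noteq> Suc 0 \<Longrightarrow> delta_Hoch_M n f g ws = 0"
  by (auto simp: delta_Hoch_M_def)

lemma delta_cochain_eq_0_iff:
  assumes q: "bilinear_quadruple q"
  shows "delta 2 (cochain q) = 0 \<longleftrightarrow> first_order q"
proof -
  obtain mu1 l1 r1 P1 where q_eq: "q = (mu1, l1, r1, P1)" by (cases q)
  define f where "f = binary_on_lists mu1"
  define g where "g = binary_on_words l1 r1"
  define \<gamma> where "\<gamma> = (\<lambda>y. if y = Graft Leaf Leaf then unary_on_lists P1 else 0)"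
  have "delta_Hoch 2 f = 0 \<longleftrightarrow> (\<forall>a b c. delta_Hoch 2 f [a, b, c] = 0)"
    by (subst fun_eq_on_lists_3_iff) (simp_all add: delta_Hoch_off)
  moreover have "delta_Hoch 2 f [a, b, c] =
      mu a (mu1 b c) - mu1 (mu a b) c + mu1 a (mu b c) - mu (mu1 a b) c" for a b c
    by (simp add: delta_Hoch_def sum_1_2 contract_def f_def)
  ultimately have f: "delta_Hoch 2 f = 0 \<longleftrightarrow>
    (\<forall>a b c. mu1 (mu a b) c + mu (mu1 a b) c = mu1 a (mu b c) + mu a (mu1 b c))"
    by (simp add: alternating_sum_eq_iff)
  \<comment> \<open>The letter from \<open>M\<close> can stand in three places, which gives the
    three bimodule axioms; on all other words \<open>delta_Hoch_M\<close> is 0 by default.\<close>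
  have "delta_Hoch_M 2 f g = 0 \<longleftrightarrow>
      (\<forall>a b u. delta_Hoch_M 2 f g [Inl a, Inl b, Inr u] = 0) \<and>
      (\<forall>a u b. delta_Hoch_M 2 f g [Inl a, Inr u, Inl b] = 0) \<and>
      (\<forall>u a b. delta_Hoch_M 2 f g [Inr u, Inl a, Inl b] = 0)"
    by (subst fun_eq_on_lists_3_iff) (auto simp: delta_Hoch_M_off split_sum_all)
  moreover have "delta_Hoch_M 2 f g [Inl a, Inl b, Inr u] =
      l a (l1 b u) - l1 (mu a b) u + l1 a (l b u) - l (mu1 a b) u"
    "delta_Hoch_M 2 f g [Inl a, Inr u, Inl b] =
      l a (r1 u b) - r1 (l a u) b + l1 a (r u b) - r (l1 a u) b"
    "delta_Hoch_M 2 f g [Inr u, Inl a, Inl b] =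
      r u (mu1 a b) - r1 (r u a) b + r1 u (mu a b) - r (r1 u a) b" for a b u
    by (simp_all add: delta_Hoch_M_def sum_1_2 contract_def f_plus_g_def f_def g_def)
  ultimately have g: "delta_Hoch_M 2 f g = 0 \<longleftrightarrow>
     (\<forall>a b u. l1 (mu a b) u + l (mu1 a b) u = l1 a (l b u) + l a (l1 b u)) \<and>
     (\<forall>a u b. r1 (l a u) b + r (l1 a u) b = l1 a (r u b) + l a (r1 u b)) \<and>
     (\<forall>u a b. r1 (r u a) b + r (r1 u a) b = r1 u (mu a b) + r u (mu1 a b))"
    by (simp add: alternating_sum_eq_iff)
  \<comment> \<open>All three operations in \<open>delta_Diass\<close> are \<open>Vdash\<close> on
    \<open>?L\<close> and \<open>Dashv\<close> on \<open>?R\<close>. The index \<open>i\<close> in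
    \<open>h_P\<close> is 2 for \<open>?L\<close> and 1 for \<open>?R\<close>, so \<open>h_P\<close>
    contributes \<open>l1\<close> and \<open>r1\<close> respectively. Hence \<open>?L\<close> yields
    the averaging identity for the left action and \<open>?R\<close> the one for the right
    action.\<close>
  let ?L = "Graft (Graft Leaf Leaf) Leaf" and ?R = "Graft Leaf (Graft Leaf Leaf)"
  let ?d = "delta_Diass 1 \<gamma> + h_P 2 f g"
  have off: "?d y us = 0" if "\<not> ((y = ?L \<or> y = ?R) \<and> length us = 2)" for y us
    using that by (auto simp: delta_Diass_def h_P_def numeral_2_eq_2 nodes_eq_2_iff)
  have "?d = 0 \<longleftrightarrow> (\<forall>u v. ?d ?L [u, v] = 0) \<and> (\<forall>u v. ?d ?R [u, v] = 0)"
  proof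
    assume on: "(\<forall>u v. ?d ?L [u, v] = 0) \<and> (\<forall>u v. ?d ?R [u, v] = 0)"
    have "?d y us = 0" for y us
    proof (cases "(y = ?L \<or> y = ?R) \<and> length us = 2")
      case True
      then obtain u v where "us = [u, v]" by (auto simp: length_eq_2_iff)
      with True on show ?thesis by blast
    qed (rule off)
    then show "?d = 0" by (intro ext) (simp only: zero_fun_def)
  qed (simp only: zero_fun_apply simp_thms)
  moreover have "?d ?L [u, v] =
      (mu1 (P u) (P v) + mu (P1 u) (P v) + mu (P u) (P1 v)) -
      (P1 (l (P u) v) + P (l1 (P u) v) + P (l (P1 u) v))" for u v
    by (simp add: delta_Diass_def h_P_def star_def contract_def f_def g_def \<gamma>_def)
  then have "?d ?L [u, v] = 0 \<longleftrightarrow>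
      P1 (l (P u) v) + P (l1 (P u) v) + P (l (P1 u) v) =
      mu1 (P u) (P v) + mu (P1 u) (P v) + mu (P u) (P1 v)" for u v
    by (simp only: right_minus_eq) (rule eq_commute)
  moreover have "?d ?R [u, v] =
      (mu1 (P u) (P v) + mu (P1 u) (P v) + mu (P u) (P1 v)) -
      (P1 (r u (P v)) + P (r1 u (P v)) + P (r u (P1 v)))" for u v
    by (simp add: delta_Diass_def h_P_def star_def contract_def f_def g_def \<gamma>_def)
  then have "?d ?R [u, v] = 0 \<longleftrightarrow>
      P1 (r u (P v)) + P (r1 u (P v)) + P (r u (P1 v)) =
      mu1 (P u) (P v) + mu (P1 u) (P v) + mu (P u) (P1 v)" for u v
    by (simp only: right_minus_eq) (rule eq_commute)
  ultimately have \<gamma>: "?d = 0 \<longleftrightarrow>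
     (\<forall>u v. P1 (l (P u) v) + P (l1 (P u) v) + P (l (P1 u) v) =
            mu1 (P u) (P v) + mu (P1 u) (P v) + mu (P u) (P1 v)) \<and>
     (\<forall>u v. P1 (r u (P v)) + P (r1 u (P v)) + P (r u (P1 v)) =
            mu1 (P u) (P v) + mu (P1 u) (P v) + mu (P u) (P1 v))"
    by (simp only:)
  have "delta 2 (cochain q) = (delta_Hoch 2 f, delta_Hoch_M 2 f g, delta_Diass 1 \<gamma> + h_P 2 f g)"
    by (simp add: q_eq cochain_def f_def g_def \<gamma>_def)
  then show ?thesis
    by (simp only: zero_prod_def prod.inject f g \<gamma> q_eq first_order_def prod.case conj_assoc)
qed

text \<open>A 1-cochain amounts to two linear maps, read off from words of one letter. Comparing
  values on words of length 2, and at the tree of \<open>Y_1\<close> in the third component, gives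
  the morphism equations.\<close>

lemma cohomologous_iff:
  "cochain q - cochain q' \<in> coboundaries 2 \<longleftrightarrow> (\<exists>\<phi> \<psi>. first_order_morphism q q' \<phi> \<psi>)"
proof -
  obtain mu1 l1 r1 P1 where q_eq: "q = (mu1, l1, r1, P1)" by (cases q)
  obtain mu2 l2 r2 P2 where q'_eq: "q' = (mu2, l2, r2, P2)" by (cases q')
  \<comment> \<open>Only the values on one-letter words enter, so this serves both for a given
    1-cochain and for the one built from \<open>\<phi>\<close> and \<open>\<psi>\<close>.\<close>
  have delta1: "cochain q - cochain q' = delta 1 (f, g, 0) \<longleftrightarrow>
     first_order_morphism q q' (\<lambda>a. f [a]) (\<lambda>u. g [Inr u])"
    if hom: "module_hom sA sA (\<lambda>a. f [a])" "module_hom sM sM (\<lambda>u. g [Inr u])" for f g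
  proof -
    have f: "binary_on_lists mu1 - binary_on_lists mu2 = delta_Hoch 1 f \<longleftrightarrow>
        (\<forall>a b. mu1 a b + f [mu a b] = mu2 a b + mu a (f [b]) + mu (f [a]) b)" (is "?lhs = ?rhs")
    proof -
      have "?lhs \<longleftrightarrow> (\<forall>a b. mu1 a b - mu2 a b = delta_Hoch 1 f [a, b])"
        by (subst fun_eq_on_lists_2_iff) (simp_all add: delta_Hoch_off binary_on_lists_zero)
      also have "\<dots> \<longleftrightarrow> ?rhs"
        by (simp add: delta_Hoch_def contract_def algebra_simps)
      finally show ?thesis .
    qed
    have g: "binary_on_words l1 r1 - binary_on_words l2 r2 = delta_Hoch_M 1 f g \<longleftrightarrow>
        (\<forall>a u. l1 a u + g [Inr (l a u)] = l2 a u + l a (g [Inr u]) + l (f [a]) u) \<and>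
        (\<forall>u a. r1 u a + g [Inr (r u a)] = r2 u a + r u (f [a]) + r (g [Inr u]) a)"
        (is "?lhs = ?rhs")
    proof -
      have "?lhs \<longleftrightarrow> (\<forall>a u. l1 a u - l2 a u = delta_Hoch_M 1 f g [Inl a, Inr u]) \<and>
          (\<forall>u a. r1 u a - r2 u a = delta_Hoch_M 1 f g [Inr u, Inl a])"
        by (subst fun_eq_on_lists_2_iff)
          (auto simp: delta_Hoch_M_off binary_on_words_zero split_sum_all)
      also have "\<dots> \<longleftrightarrow> ?rhs"
        by (simp add: delta_Hoch_M_def contract_def f_plus_g_def algebra_simps)
      finally show ?thesis .
    qed
    \<comment> \<open>The term \<open>delta_Diass 0 0\<close> vanishes because the operations are 0
      at the argument 0 of \<open>A\<close>. The sign -1 in \<open>h_P 1\<close> puts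
      \<open>f [P u]\<close> on the side of \<open>P1 u\<close>.\<close>
    have \<gamma>: "(\<lambda>y. if y = Graft Leaf Leaf then unary_on_lists P1 else 0) -
        (\<lambda>y. if y = Graft Leaf Leaf then unary_on_lists P2 else 0) =
        delta_Diass 0 0 + h_P 1 f g \<longleftrightarrow>
        (\<forall>u. P1 u + f [P u] = P2 u + P (g [Inr u]))" (is "?D1 - ?D2 = ?d \<longleftrightarrow> ?rhs")
    proof -
      let ?Y = "Graft Leaf Leaf"
      have off: "(?D1 - ?D2) y us = ?d y us" if "\<not> (y = ?Y \<and> length us = 1)" for y us
        using that by (auto simp: unary_on_lists_zero delta_Diass_def h_P_def nodes_eq_1_iff)
      have "?D1 - ?D2 = ?d \<longleftrightarrow> (\<forall>u. P1 u - P2 u = ?d ?Y [u])"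
      proof
        assume "?D1 - ?D2 = ?d"
        then have "(?D1 - ?D2) ?Y [u] = ?d ?Y [u]" for u
          by (simp only:)
        then show "\<forall>u. P1 u - P2 u = ?d ?Y [u]"
          by simp
      next
        assume on: "\<forall>u. P1 u - P2 u = ?d ?Y [u]"
        show "?D1 - ?D2 = ?d"
        proof (intro ext)
          fix y us
          show "(?D1 - ?D2) y us = ?d y us"
          proof (cases "y = ?Y \<and> length us = 1")
            case True
            then obtain u where "y = ?Y" "us = [u]" by (auto simp: length_Suc_conv)
            then show ?thesis using on by simp
          qed (rule off)
        qed
      qed
      also have "\<dots> \<longleftrightarrow> ?rhs"
        by (simp add: delta_Diass_def h_P_def star_def algebra_simps)
      finally show ?thesis .
    qed
    show ?thesis
      unfolding q_eq q'_eq cochain_def first_order_morphism_def delta.simps prod.case minus_prod_def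
        fst_conv snd_conv prod.inject diff_self_eq_0 f g \<gamma>
      by (simp only: hom simp_thms conj_assoc)
  qed
  have mem: "(f, g, \<gamma>) \<in> cochains (Suc 0) \<longleftrightarrow>
    multilinear sA sA (Suc 0) f \<and> mixed_multilinear sA sM (Suc 0) g \<and> \<gamma> = 0" for f g \<gamma>
    by (simp add: cochains_def)
  show ?thesis
  proof
    assume "cochain q - cochain q' \<in> coboundaries 2"
    then obtain c where c: "c \<in> cochains (Suc 0)" "cochain q - cochain q' = delta 1 c"
      by (auto simp: coboundaries_def simp del: delta.simps)
    obtain f g where c_eq: "c = (f, g, 0)"
      using c(1) mem by (cases c) blast
    have "module_hom sA sA (\<lambda>a. f [a])" "module_hom sM sM (\<lambda>u. g [Inr u])"
      using c(1) unfolding c_eq mem multilinear_1_iff mixed_multilinear_1_iff by blast+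
    with c(2) show "\<exists>\<phi> \<psi>. first_order_morphism q q' \<phi> \<psi>"
      using delta1 unfolding c_eq by blast
  next
    assume "\<exists>\<phi> \<psi>. first_order_morphism q q' \<phi> \<psi>"
    then obtain \<phi> \<psi> where fo: "first_order_morphism q q' \<phi> \<psi>" by blast
    then have hom: "module_hom sA sA \<phi>" "module_hom sM sM \<psi>"
      by (auto simp: first_order_morphism_def split: prod.splits)
    \<comment> \<open>The maps are extended by 0 to all other lists and words.\<close>
    let ?f = "unary_on_lists \<phi>" and ?g = "unary_on_words \<psi>"
    have "(?f, ?g, 0) \<in> cochains (Suc 0)"
      by (simp add: mem multilinear_1_iff mixed_multilinear_1_iff hom
          unary_on_lists_zero unary_on_words_zero)
    moreover have "cochain q - cochain q' = delta 1 (?f, ?g, 0)"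
      by (subst delta1) (simp_all add: fo hom)
    ultimately show "cochain q - cochain q' \<in> coboundaries 2"
      by (auto simp: coboundaries_def simp del: delta.simps)
  qed
qed

section \<open>Passage to classes\<close>

lemma bij_betw_cocycles:
  "bij_betw cochain {q. bilinear_quadruple q \<and> first_order q} (cocycles 2)"
proof (rule bij_betw_subset[OF bij_betw_cochain])
  show "cochain ` {q. bilinear_quadruple q \<and> first_order q} = cocycles 2"
    unfolding cocycles_def bij_betw_imp_surj_on[OF bij_betw_cochain, symmetric]
    by (auto simp: delta_cochain_eq_0_iff)
qed auto

lemma deformation_classes_bij_cohomology:
  "\<exists>\<Phi>. bij_betw \<Phi> deformation_classes (cohomology 2)"
proof -
  let ?X = "{q. bilinear_quadruple q \<and> first_order q}"
  let ?R = "\<lambda>q q'. \<exists>\<phi> \<psi>. first_order_morphism q q' \<phi> \<psi>"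
  \<comment> \<open>\<open>?Q\<close> maps bijectively to both sides, so the required map goes back
    along \<open>image deform\<close> and then forward along \<open>image cochain\<close>.\<close>
  let ?Q = "?X // {(q, q'). q \<in> ?X \<and> q' \<in> ?X \<and> ?R q q'}"
  have "bij_betw (image deform) ?Q deformation_classes"
    unfolding deformation_classes_def
    by (rule bij_betw_quotients[OF bij_betw_deform]) (simp add: deformation_equiv_deform_iff)
  moreover have "bij_betw (image cochain) ?Q (cohomology 2)"
    unfolding cohomology_def
    by (rule bij_betw_quotients[OF bij_betw_cocycles]) (simp add: cohomologous_iff)
  ultimately have "bij_betw (image cochain \<circ> inv_into ?Q (image deform))
      deformation_classes (cohomology 2)"
    by (rule bij_betw_trans[OF bij_betw_inv_into])
  then show ?thesis by blast
qed

end

theorem theorem6p4: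
  fixes sA :: "'k::field_char_0 \<Rightarrow> 'a::ab_group_add \<Rightarrow> 'a"
    and mu :: "'a \<Rightarrow> 'a \<Rightarrow> 'a"
    and sM :: "'k \<Rightarrow> 'm::ab_group_add \<Rightarrow> 'm"
    and l :: "'a \<Rightarrow> 'm \<Rightarrow> 'm"
    and r :: "'m \<Rightarrow> 'a \<Rightarrow> 'm"
    and P :: "'m \<Rightarrow> 'a"
  assumes "assoc_algebra sA mu"
    and "bimodule sA mu sM l r"
    and "relative_averaging_operator sA mu sM l r P"
  shows "\<exists>\<Phi>. bij_betw \<Phi>
           (rel_avg.deformation_classes sA mu sM l r P)
           (rel_avg.cohomology sA mu sM l r P 2)"
proof -
  interpret relative_averaging sA mu sM l r P
    using assms by unfold_locales
  show ?thesis by (rule deformation_classes_bij_cohomology)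
qed

end
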